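(* For every prime power $q$, the power graph of $G_2(q)$ is not a chordal graph.
   Context: The power graph $\mathcal{P}(G)$ of a group $G$ is the undirected simple graph with vertex set $G$ in which distinct $a,b$ are adjacent iff $a=b^m$ or $b=a^n$ for some positive integers $m,n$. A graph is chordal if it has no induced cycle of length $4$ or more. $G_2(q)$ is the Chevalley group of type $G_2$ over $GF(q)$. *)

theory Defs
  imports
    "HOL-Analysis.Cartesian_Space"
    "HOL-Algebra.Generated_Groups"
    "HOL-Number_Theory.Prime_Powers"
begin

section \<open>Simple graphs, chordality, power graphs\<close>

text \<open>A graph is a vertex set together with a set of unordered pairs.\<close>

type_synonym 'a ugraph = "'a set \<times> 'a set set"

text \<open>The list \<open>vs\<close> enumerates the vertices of an induced cycle in cyclic order.  The condition
  on \<open>i = j\<close> only says that there is no loop at \<open>vs ! i\<close>.\<close>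

definition induced_cycle :: "'a ugraph \<Rightarrow> 'a list \<Rightarrow> bool" where
  "induced_cycle \<Gamma> vs \<longleftrightarrow>
     length vs \<ge> 3 \<and> distinct vs \<and> set vs \<subseteq> fst \<Gamma> \<and>
     (\<forall>i < length vs. \<forall>j < length vs.
        {vs ! i, vs ! j} \<in> snd \<Gamma> \<longleftrightarrow>
          j = Suc i mod length vs \<or> i = Suc j mod length vs)"

definition chordal :: "'a ugraph \<Rightarrow> bool" where
  "chordal \<Gamma> \<longleftrightarrow> \<not> (\<exists>vs. length vs \<ge> 4 \<and> induced_cycle \<Gamma> vs)"

definition power_graph :: "('a, 'b) monoid_scheme \<Rightarrow> 'a ugraph" where
  "power_graph G =
     (carrier G,
      {{a, b} | a b. a \<in> carrier G \<and> b \<in> carrier G \<and> a \<noteq> b \<and>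
         ((\<exists>m::nat. m > 0 \<and> a = b [^]\<^bsub>G\<^esub> m) \<or> (\<exists>n::nat. n > 0 \<and> b = a [^]\<^bsub>G\<^esub> n))})"

section \<open>The root system of type \<open>G\<^sub>2\<close>\<close>

text \<open>Roots are written \<open>i a + j b\<close> with \<open>a\<close> the short and \<open>b\<close> the long simple root;
  for instance \<open>P32\<close> is \<open>3 a + 2 b\<close>.\<close>

datatype g2_pos = P10 | P01 | P11 | P21 | P31 | P32

datatype g2_root = Pos g2_pos | Neg g2_pos

fun pos_coords :: "g2_pos \<Rightarrow> int \<times> int" where
  "pos_coords P10 = (1, 0)"
| "pos_coords P01 = (0, 1)"
| "pos_coords P11 = (1, 1)"
| "pos_coords P21 = (2, 1)"
| "pos_coords P31 = (3, 1)"
| "pos_coords P32 = (3, 2)"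

fun coords :: "g2_root \<Rightarrow> int \<times> int" where
  "coords (Pos r) = pos_coords r"
| "coords (Neg r) = - pos_coords r"

definition g2_roots :: "g2_root list" where
  "g2_roots = (let ps = [P10, P01, P11, P21, P31, P32] in map Pos ps @ map Neg ps)"

text \<open>The invariant form, scaled so that \<open>(a, a) = 2\<close>, \<open>(b, b) = 6\<close> and \<open>(a, b) = -3\<close>.\<close>

fun root_form :: "int \<times> int \<Rightarrow> int \<times> int \<Rightarrow> int" where
  "root_form (i, j) (k, l) = 2 * i * k - 3 * (i * l + j * k) + 6 * j * l"

text \<open>The Cartan integer \<open>2 (r, s) / (r, r)\<close>; the division is exact.\<close>

definition cartan_int :: "int \<times> int \<Rightarrow> int \<times> int \<Rightarrow> int" where
  "cartan_int r s = 2 * root_form r s div root_form r r"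

section \<open>The integral Lie algebra with its Chevalley basis\<close>

text \<open>\<open>Ha\<close> and \<open>Hb\<close> are the co-roots of the simple roots, \<open>Evec r\<close> is the root vector of \<open>r\<close>.\<close>

datatype g2_basis = Ha | Hb | Evec g2_root

text \<open>The largest \<open>p\<close> for which \<open>s - p r\<close> is a root.\<close>

definition string_down :: "g2_root \<Rightarrow> g2_root \<Rightarrow> int" where
  "string_down r s =
     Max {p \<in> {0..3}. coords s - (p * fst (coords r), p * snd (coords r)) \<in> set (map coords g2_roots)}"

text \<open>In a Chevalley basis \<open>N\<^sub>r\<^sub>s = \<plusminus>(p + 1)\<close>, \<open>N\<^sub>s\<^sub>r = - N\<^sub>r\<^sub>s\<close>, \<open>N\<close> changes sign under
  \<open>(r, s) \<mapsto> (-r, -s)\<close>, and for roots with \<open>r + s + t = 0\<close>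
  the numbers \<open>N\<^sub>r\<^sub>s / (t, t)\<close>, \<open>N\<^sub>s\<^sub>t / (r, r)\<close>, \<open>N\<^sub>t\<^sub>r / (s, s)\<close> agree.  Hence the signs are
  determined by those on pairs of positive roots.  The extraspecial pairs, listed first, may be
  given the sign \<open>+\<close>; the sign of the last pair is then forced by the Jacobi identity.\<close>

definition sign_pairs :: "((int \<times> int) \<times> (int \<times> int)) list" where
  "sign_pairs =
     [((1, 0), (0, 1)), ((1, 0), (1, 1)), ((1, 0), (2, 1)), ((0, 1), (3, 1)), ((2, 1), (1, 1))]"

definition sgn_const :: "g2_root \<Rightarrow> g2_root \<Rightarrow> int" where
  "sgn_const r s =
     (let u = coords r; v = coords s; w = - (u + v) in
      if \<exists>(x, y) \<in> {(u, v), (v, w), (w, u)}. (x, y) \<in> set sign_pairs \<or> (- y, - x) \<in> set sign_pairs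
      then 1 else -1)"

definition N_const :: "g2_root \<Rightarrow> g2_root \<Rightarrow> int" where
  "N_const r s = sgn_const r s * (string_down r s + 1)"

text \<open>\<open>lie_coeff x y z\<close> is the coefficient of \<open>z\<close> in the bracket \<open>[x, y]\<close>:
  \<open>[h\<^sub>r, e\<^sub>s] = 2 (r, s) / (r, r) e\<^sub>s\<close>, \<open>[e\<^sub>r, e\<^sub>s] = N\<^sub>r\<^sub>s e\<^sub>r\<^sub>+\<^sub>s\<close>, and
  \<open>[e\<^sub>r, e\<^bsub>-r\<^esub>]\<close> is the co-root of \<open>r\<close>, which for \<open>r = i a + j b\<close> is
  \<open>i (a, a) / (r, r) h\<^sub>a + j (b, b) / (r, r) h\<^sub>b\<close>, with integral coefficients.\<close>

fun lie_coeff :: "g2_basis \<Rightarrow> g2_basis \<Rightarrow> g2_basis \<Rightarrow> int" where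
  "lie_coeff (Evec r) (Evec s) (Evec t) = (if coords r + coords s = coords t then N_const r s else 0)"
| "lie_coeff (Evec r) (Evec s) Ha =
     (if coords r + coords s = 0 then 2 * fst (coords r) div root_form (coords r) (coords r) else 0)"
| "lie_coeff (Evec r) (Evec s) Hb =
     (if coords r + coords s = 0 then 6 * snd (coords r) div root_form (coords r) (coords r) else 0)"
| "lie_coeff Ha (Evec s) (Evec t) = (if s = t then cartan_int (1, 0) (coords s) else 0)"
| "lie_coeff Hb (Evec s) (Evec t) = (if s = t then cartan_int (0, 1) (coords s) else 0)"
| "lie_coeff (Evec r) Ha (Evec t) = (if r = t then - cartan_int (1, 0) (coords r) else 0)"
| "lie_coeff (Evec r) Hb (Evec t) = (if r = t then - cartan_int (0, 1) (coords r) else 0)"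
| "lie_coeff _ _ _ = 0"

definition g2_basis_list :: "g2_basis list" where
  "g2_basis_list = Ha # Hb # map Evec g2_roots"

lemma set_g2_roots: "set g2_roots = UNIV"
proof -
  have "r \<in> set g2_roots" for r
  proof (cases r)
    case (Pos p) then show ?thesis by (cases p) (auto simp: g2_roots_def Let_def)
  next
    case (Neg p) then show ?thesis by (cases p) (auto simp: g2_roots_def Let_def)
  qed
  then show ?thesis by blast
qed

lemma set_g2_basis_list: "set g2_basis_list = UNIV"
proof -
  have "x \<in> set g2_basis_list" for x
    by (cases x) (auto simp: g2_basis_list_def set_g2_roots)
  then show ?thesis by blast
qed

lemma distinct_g2_basis_list: "distinct g2_basis_list"
  by (simp add: g2_basis_list_def g2_roots_def Let_def)

instance g2_basis :: finite
  by standard (metis set_g2_basis_list List.finite_set)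

section \<open>The Chevalley group\<close>

text \<open>All matrices are with respect to the Chevalley basis and act on column vectors.\<close>

definition ad_root :: "g2_root \<Rightarrow> int^g2_basis^g2_basis" where
  "ad_root r = (\<chi> z y. lie_coeff (Evec r) y z)"

text \<open>The divided power \<open>(ad e\<^sub>r)\<^sup>i / i!\<close>, which is an integral matrix
  (see \<open>divided_power_exact\<close> below).\<close>

definition divided_power :: "g2_root \<Rightarrow> nat \<Rightarrow> int^g2_basis^g2_basis" where
  "divided_power r i = (\<chi> z y. (((**) (ad_root r) ^^ i) (mat 1)) $ z $ y div fact i)"

text \<open>\<open>x\<^sub>r(t) = exp (t ad e\<^sub>r)\<close>, reduced to \<open>'k\<close>; the series stops since \<open>(ad e\<^sub>r)\<^sup>4 = 0\<close>
  (see \<open>ad_root_nilpotent\<close> below).\<close>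

definition root_elt :: "g2_root \<Rightarrow> 'k::field \<Rightarrow> 'k^g2_basis^g2_basis" where
  "root_elt r t = (\<Sum>i\<le>3. \<chi> z y. t ^ i * of_int (divided_power r i $ z $ y))"

definition GL :: "('k::field^'n^'n) monoid" where
  "GL = \<lparr>carrier = {M. invertible M}, monoid.mult = (**), one = mat 1\<rparr>"

definition G2 :: "('k::field^g2_basis^g2_basis) monoid" where
  "G2 = subgroup_generated GL {root_elt r t | r t. True}"

section \<open>Sanity checks\<close>

text \<open>Integer vectors as sparse lists, used to verify identities of structure constants by
  evaluation.\<close>

definition sp_bracket :: "g2_basis \<Rightarrow> g2_basis \<Rightarrow> (g2_basis \<times> int) list" where
  "sp_bracket x y =
     filter (\<lambda>(z, k). k \<noteq> 0) (map (\<lambda>z. (z, lie_coeff x y z)) g2_basis_list)"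

definition sp_apply :: "g2_basis \<Rightarrow> (g2_basis \<times> int) list \<Rightarrow> (g2_basis \<times> int) list" where
  "sp_apply x l = concat (map (\<lambda>(u, k). map (\<lambda>(z, m). (z, k * m)) (sp_bracket x u)) l)"

definition sp_coeff :: "(g2_basis \<times> int) list \<Rightarrow> g2_basis \<Rightarrow> int" where
  "sp_coeff l z = sum_list (map (\<lambda>(u, k). if u = z then k else 0) l)"

lemma sp_coeff_bracket: "sp_coeff (sp_bracket x y) z = lie_coeff x y z"
proof -
  have "sp_coeff (filter (\<lambda>(z, k). k \<noteq> 0) (map (\<lambda>z. (z, f z)) l)) z =
      (\<Sum>u\<leftarrow>l. if u = z then f u else 0)" for f :: "g2_basis \<Rightarrow> int" and l
    by (induction l) (auto simp: sp_coeff_def)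
  also have "(\<Sum>u\<leftarrow>g2_basis_list. if u = z then f u else 0) = f z" for f :: "g2_basis \<Rightarrow> int"
    by (simp add: sum_list_distinct_conv_sum_set distinct_g2_basis_list set_g2_basis_list)
  finally show ?thesis by (simp add: sp_bracket_def)
qed

lemma sp_coeff_apply: "sp_coeff (sp_apply x l) z = (\<Sum>u\<in>UNIV. lie_coeff x u z * sp_coeff l u)"
proof (induction l)
  case Nil
  then show ?case by (simp add: sp_apply_def sp_coeff_def)
next
  case (Cons p l)
  obtain u k where p: "p = (u, k)" by fastforce
  have *: "sp_coeff (map (\<lambda>(z, m). (z, k * m)) l') z = k * sp_coeff l' z" for l'
    by (induction l') (auto simp: sp_coeff_def algebra_simps)
  have "sp_coeff (sp_apply x (p # l)) z =
      sp_coeff (map (\<lambda>(z, m). (z, k * m)) (sp_bracket x u)) z + sp_coeff (sp_apply x l) z"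
    by (simp add: sp_apply_def sp_coeff_def p)
  also have "\<dots> = k * lie_coeff x u z + (\<Sum>v\<in>UNIV. lie_coeff x v z * sp_coeff l v)"
    by (simp add: * sp_coeff_bracket Cons.IH)
  also have "k * lie_coeff x u z = (\<Sum>v\<in>UNIV. if u = v then lie_coeff x v z * k else 0)"
    by simp
  finally show ?case
    by (simp add: p sp_coeff_def distrib_left if_distrib [of "(*) _"] sum.distrib cong: if_cong)
qed

lemma sp_coeff_eq_0: "z \<notin> fst ` set l \<Longrightarrow> sp_coeff l z = 0"
  by (induction l) (auto simp: sp_coeff_def)

lemma sp_coeff_append: "sp_coeff (l @ l') z = sp_coeff l z + sp_coeff l' z"
  by (simp add: sp_coeff_def)

lemma lie_coeff_antisym_eval:
  "list_all (\<lambda>x. list_all (\<lambda>y. list_all (\<lambda>z. lie_coeff x y z = - lie_coeff y x z)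
     g2_basis_list) g2_basis_list) g2_basis_list"
  by code_simp

lemma lie_coeff_antisym: "lie_coeff x y z = - lie_coeff y x z"
  using lie_coeff_antisym_eval unfolding list_all_iff set_g2_basis_list by blast

definition jacobi_list :: "g2_basis \<Rightarrow> g2_basis \<Rightarrow> g2_basis \<Rightarrow> (g2_basis \<times> int) list" where
  "jacobi_list x y z =
     sp_apply x (sp_bracket y z) @ sp_apply y (sp_bracket z x) @ sp_apply z (sp_bracket x y)"

lemma sp_coeff_jacobi_list:
  "sp_coeff (jacobi_list x y z) w =
     (\<Sum>u\<in>UNIV. lie_coeff x u w * lie_coeff y z u) +
     (\<Sum>u\<in>UNIV. lie_coeff y u w * lie_coeff z x u) +
     (\<Sum>u\<in>UNIV. lie_coeff z u w * lie_coeff x y u)"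
  by (simp add: jacobi_list_def sp_coeff_append sp_coeff_apply sp_coeff_bracket)

lemma jacobi_list_rotate: "sp_coeff (jacobi_list x y z) w = sp_coeff (jacobi_list y z x) w"
  by (simp add: sp_coeff_jacobi_list)

lemma jacobi_list_swap: "sp_coeff (jacobi_list x y z) w = - sp_coeff (jacobi_list y x z) w"
proof -
  have "(\<Sum>u\<in>UNIV. lie_coeff p u w * lie_coeff q r u) =
      - (\<Sum>u\<in>UNIV. lie_coeff p u w * lie_coeff r q u)" for p q r
    by (subst lie_coeff_antisym [of q r]) (simp add: sum_negf)
  from this [of x y z] this [of y z x] this [of z x y] show ?thesis
    by (simp add: sp_coeff_jacobi_list)
qed

lemma jacobi_list_same: "sp_coeff (jacobi_list x x z) w = 0"
  using jacobi_list_swap [of x x z w] by simp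

lemma lie_coeff_jacobi_eval:
  "list_all (\<lambda>i. list_all (\<lambda>j. list_all (\<lambda>k.
     let l = jacobi_list (g2_basis_list ! i) (g2_basis_list ! j) (g2_basis_list ! k)
     in list_all (\<lambda>w. sp_coeff l w = 0) (map fst l)) [0..<j]) [0..<i]) [0..<14]"
  by code_simp

lemma lie_coeff_jacobi:
  "(\<Sum>u\<in>UNIV. lie_coeff x u w * lie_coeff y z u) +
   (\<Sum>u\<in>UNIV. lie_coeff y u w * lie_coeff z x u) +
   (\<Sum>u\<in>UNIV. lie_coeff z u w * lie_coeff x y u) = 0"
proof -
  define J where "J x y z \<longleftrightarrow> sp_coeff (jacobi_list x y z) w = 0" for x y z
  have rot: "J x y z \<longleftrightarrow> J y z x" for x y z
    by (simp add: J_def jacobi_list_rotate [of x y z])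
  have swap: "J x y z \<longleftrightarrow> J y x z" for x y z
    by (simp add: J_def jacobi_list_swap [of x y z])
  have same: "J x x z" for x z
    by (simp add: J_def jacobi_list_same)
  have len: "length g2_basis_list = 14"
    by (simp add: g2_basis_list_def g2_roots_def Let_def)
  have *: "J (g2_basis_list ! i) (g2_basis_list ! j) (g2_basis_list ! k)"
    if "k < j" "j < i" "i < 14" for i j k
  proof -
    define l where "l = jacobi_list (g2_basis_list ! i) (g2_basis_list ! j) (g2_basis_list ! k)"
    have "list_all (\<lambda>w. sp_coeff l w = 0) (map fst l)"
      using lie_coeff_jacobi_eval that unfolding list_all_iff l_def Let_def by auto
    then have "sp_coeff l w = 0"
      by (cases "w \<in> fst ` set l") (auto simp: list_all_iff sp_coeff_eq_0)
    then show ?thesis by (simp add: J_def l_def)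
  qed
  obtain i j k where ijk: "i < 14" "j < 14" "k < 14"
      "x = g2_basis_list ! i" "y = g2_basis_list ! j" "z = g2_basis_list ! k"
    by (metis UNIV_I in_set_conv_nth set_g2_basis_list len)
  consider "i = j" | "j = k" | "i = k" | "k < j" "j < i" | "j < k" "k < i" | "k < i" "i < j"
    | "i < k" "k < j" | "i < j" "j < k" | "j < i" "i < k"
    by linarith
  then have "J x y z"
    using * [of k j i] * [of j k i] * [of k i j] * [of i k j] * [of i j k] * [of j i k] ijk
    by cases (metis rot swap same)+
  then show ?thesis by (simp add: J_def sp_coeff_jacobi_list)
qed

definition sp_power :: "g2_root \<Rightarrow> nat \<Rightarrow> g2_basis \<Rightarrow> (g2_basis \<times> int) list" where
  "sp_power r i y = (sp_apply (Evec r) ^^ i) [(y, 1)]"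

lemma sp_coeff_power: "sp_coeff (sp_power r i y) z = (((**) (ad_root r) ^^ i) (mat 1)) $ z $ y"
proof (induction i arbitrary: z)
  case 0
  then show ?case by (auto simp: sp_power_def sp_coeff_def mat_def)
next
  case (Suc i)
  then show ?case
    by (simp add: sp_power_def sp_coeff_apply matrix_matrix_mult_def ad_root_def)
qed

lemma sp_power_eval:
  "list_all (\<lambda>r. list_all (\<lambda>y.
     (let l2 = sp_apply (Evec r) (sp_apply (Evec r) [(y, 1)]);
          l3 = sp_apply (Evec r) l2; l4 = sp_apply (Evec r) l3
      in list_all (\<lambda>z. even (sp_coeff l2 z)) (map fst l2) \<and>
         list_all (\<lambda>z. sp_coeff l3 z mod 6 = 0) (map fst l3) \<and>
         list_all (\<lambda>z. sp_coeff l4 z = 0) (map fst l4)))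
     g2_basis_list) g2_roots"
  by code_simp

lemma sp_power_facts:
  "even (sp_coeff (sp_power r 2 y) z)"
  "6 dvd sp_coeff (sp_power r 3 y) z"
  "sp_coeff (sp_power r 4 y) z = 0"
proof -
  have "list_all (\<lambda>z. even (sp_coeff (sp_power r 2 y) z)) (map fst (sp_power r 2 y)) \<and>
      list_all (\<lambda>z. sp_coeff (sp_power r 3 y) z mod 6 = 0) (map fst (sp_power r 3 y)) \<and>
      list_all (\<lambda>z. sp_coeff (sp_power r 4 y) z = 0) (map fst (sp_power r 4 y))"
    using sp_power_eval
    unfolding list_all_iff set_g2_basis_list set_g2_roots Let_def
    by (simp add: sp_power_def eval_nat_numeral)
  then show "even (sp_coeff (sp_power r 2 y) z)" "6 dvd sp_coeff (sp_power r 3 y) z"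
      "sp_coeff (sp_power r 4 y) z = 0"
    by (auto simp: list_all_iff sp_coeff_eq_0 mod_eq_0_iff_dvd
        intro: ccontr dest: sp_coeff_eq_0)
       (metis sp_coeff_eq_0 dvd_0_right imageE mod_0_imp_dvd prod.collapse)+
qed

abbreviation ad_power :: "g2_root \<Rightarrow> nat \<Rightarrow> int^g2_basis^g2_basis" where
  "ad_power r i \<equiv> ((**) (ad_root r) ^^ i) (mat 1)"

lemma ad_root_nilpotent: "i \<ge> 4 \<Longrightarrow> ad_power r i = 0"
proof (induction i rule: dec_induct)
  case base
  then show ?case by (simp add: vec_eq_iff flip: sp_coeff_power) (simp add: sp_power_facts)
next
  case (step i)
  then show ?case by simp
qed

lemma divided_power_exact: "ad_power r i $ z $ y = fact i * divided_power r i $ z $ y"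
proof -
  have "fact i dvd ad_power r i $ z $ y"
  proof (cases "i \<ge> 4")
    case True
    then show ?thesis by (simp add: ad_root_nilpotent)
  next
    case False
    then consider "i = 0" | "i = 1" | "i = 2" | "i = 3" by linarith
    then show ?thesis
    proof cases
      case 3
      then show ?thesis using sp_power_facts(1) [of r y z] by (simp add: sp_coeff_power)
    next
      case 4
      then have "fact i = (6 :: int)" by (simp add: fact_numeral)
      then show ?thesis using sp_power_facts(2) [of r y z] 4 by (simp add: sp_coeff_power)
    qed simp_all
  qed
  then show ?thesis by (simp add: divided_power_def)
qed

lemma ad_power_add: "ad_power r i ** ad_power r j = ad_power r (i + j)"
  by (induction i) (simp_all flip: matrix_mul_assoc)

lemma divided_power_mult:
  "(\<Sum>u\<in>UNIV. divided_power r i $ z $ u * divided_power r j $ u $ y) =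
   int (i + j choose i) * divided_power r (i + j) $ z $ y"
proof -
  have "fact i * fact j * (\<Sum>u\<in>UNIV. divided_power r i $ z $ u * divided_power r j $ u $ y) =
      (ad_power r i ** ad_power r j) $ z $ y"
    by (simp add: matrix_matrix_mult_def divided_power_exact sum_distrib_left mult_ac)
  also have "\<dots> = fact (i + j) * divided_power r (i + j) $ z $ y"
    by (simp only: ad_power_add divided_power_exact)
  also have "fact (i + j) = (fact i * fact j * int (i + j choose i) :: int)"
    using binomial_fact_lemma [of i "i + j"]
    by (metis add_diff_cancel_left' le_add1 of_nat_fact of_nat_mult)
  finally show ?thesis by simp
qed

lemma root_elt_nth:
  "root_elt r t $ z $ y = (\<Sum>i\<le>3. t ^ i * of_int (divided_power r i $ z $ y))"
  by (simp add: root_elt_def)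

lemma divided_power_eq_0: "i \<ge> 4 \<Longrightarrow> divided_power r i = 0"
  by (simp add: divided_power_def ad_root_nilpotent vec_eq_iff)

lemma root_elt_add: "root_elt r t ** root_elt r u = root_elt r (t + u)"
proof -
  define D where "D i z y = (of_int (divided_power r i $ z $ y) :: 'a)" for i z y
  have D0: "D i z y = 0" if "i \<ge> 4" for i z y
    by (simp add: D_def divided_power_eq_0 that)
  have mult: "(\<Sum>v\<in>UNIV. D i z v * D j v y) = of_nat (i + j choose i) * D (i + j) z y" for i j z y
    using arg_cong [OF divided_power_mult [of r i z j y], of "of_int :: int \<Rightarrow> 'a"]
    by (simp add: D_def)
  have upto: "{..3::nat} = {0, 1, 2, 3}" by auto
  have "(root_elt r t ** root_elt r u) $ z $ y = (\<Sum>i\<le>3. (t + u) ^ i * D i z y)" for z y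
  proof -
    have "(root_elt r t ** root_elt r u) $ z $ y =
        (\<Sum>v\<in>UNIV. \<Sum>i\<le>3. \<Sum>j\<le>3. (t ^ i * D i z v) * (u ^ j * D j v y))"
      by (simp only: matrix_matrix_mult_def vec_lambda_beta root_elt_nth D_def [symmetric] sum_product)
    also have "\<dots> = (\<Sum>i\<le>3. \<Sum>v\<in>UNIV. \<Sum>j\<le>3. (t ^ i * D i z v) * (u ^ j * D j v y))"
      by (rule sum.swap)
    also have "\<dots> = (\<Sum>i\<le>3. \<Sum>j\<le>3. \<Sum>v\<in>UNIV. (t ^ i * D i z v) * (u ^ j * D j v y))"
      by (intro sum.cong refl sum.swap)
    also have "\<dots> = (\<Sum>i\<le>3. \<Sum>j\<le>3. t ^ i * u ^ j * (\<Sum>v\<in>UNIV. D i z v * D j v y))"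
      by (simp only: sum_distrib_left mult_ac)
    also have "\<dots> = (\<Sum>i\<le>3. (t + u) ^ i * D i z y)"
      unfolding mult upto by (simp add: D0 eval_nat_numeral algebra_simps)
    finally show ?thesis .
  qed
  then show ?thesis
    by (simp add: vec_eq_iff root_elt_nth D_def)
qed

lemma root_elt_0: "root_elt r 0 = mat 1"
proof -
  have upto: "{..3::nat} = {0, 1, 2, 3}" by auto
  show ?thesis
    by (simp add: vec_eq_iff root_elt_nth divided_power_def upto mat_def)
qed

lemma invertible_root_elt: "invertible (root_elt r t)"
  unfolding invertible_def by (metis root_elt_add root_elt_0 add.right_inverse add.left_inverse)

lemma group_GL: "group (GL :: ('k::field^'n^'n) monoid)"
proof (rule groupI)
  fix M :: "'k^'n^'n"
  assume "M \<in> carrier GL"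
  then show "\<exists>N \<in> carrier GL. N \<otimes>\<^bsub>GL\<^esub> M = \<one>\<^bsub>GL\<^esub>"
    by (auto simp: GL_def invertible_def)
next
  show "\<one>\<^bsub>GL\<^esub> \<in> carrier (GL :: ('k^'n^'n) monoid)"
    by (auto simp: GL_def invertible_def)
qed (auto simp: GL_def invertible_mult matrix_mul_assoc)

lemma group_G2: "group (G2 :: ('k::field^g2_basis^g2_basis) monoid)"
  unfolding G2_def by (rule group.group_subgroup_generated [OF group_GL])

lemma root_elt_in_GL: "root_elt r t \<in> carrier GL"
  by (simp add: GL_def invertible_root_elt)

lemma root_elt_in_G2: "root_elt r t \<in> carrier G2"
  unfolding G2_def carrier_subgroup_generated
  by (rule generate.incl) (auto simp: root_elt_in_GL)

end

theory Submission
  imports Defs "HOL-Number_Theory.Cong"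
begin

text \<open>
  Suppose that a group contains two pairs \<open>a, b\<close> and \<open>c, d\<close> such that each of \<open>a, b\<close> commutes
  with each of \<open>c, d\<close>, neither pair commutes internally, and the exponents of the two pairs are
  coprime.  Then \<open>a, ac, c, bc, b, bd, d, ad\<close> is an induced octagon of the power graph: by the
  Chinese remainder theorem a product \<open>ac\<close> has both factors among its powers, while a power of
  \<open>ac\<close> that lies in one of the pairs must be \<open>a\<close> or \<open>c\<close>, since powers of one element commute.
  This is \<open>power_graph_not_chordal\<close>, and it remains to find such pairs in \<open>G\<^sub>2(q)\<close>.

  Let \<open>\<alpha>\<close> be the short and \<open>\<beta>\<close> the long simple root, and \<open>p\<close> the characteristic.  The roots \<open>\<alpha>\<close>
  and \<open>3\<alpha> + 2\<beta>\<close> are orthogonal, and neither their sum nor their difference is a root, so the root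
  subgroups of \<open>\<plusminus>\<alpha>\<close> and those of \<open>\<plusminus>(3\<alpha> + 2\<beta>)\<close> generate two commuting copies of \<open>SL\<^sub>2(q)\<close>.
  For odd \<open>q\<close> the first contains two noncommuting elements of order \<open>p\<close>, namely \<open>x\<^sub>\<alpha>(1)\<close> and
  \<open>x\<^sub>-\<^sub>\<alpha>(1)\<close>, and the second contains two noncommuting elements of order \<open>4\<close>, because a matrix of
  determinant \<open>1\<close> and trace \<open>0\<close> squares to \<open>-1\<close>.

  For \<open>q = 2\<close> the two copies of \<open>SL\<^sub>2(q)\<close> are symmetric groups of degree \<open>3\<close>, in whose product
  all elements of order \<open>3\<close> commute.  For even \<open>q\<close> one therefore works inside \<open>G\<^sub>2(2)\<close>, in the
  centralizer of the involution \<open>x\<^bsub>3\<alpha>+2\<beta>\<^esub>(1)\<close>.  Its largest normal \<open>2\<close>-subgroup is generated by the root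
  elements \<open>x\<^sub>r(1)\<close> with \<open>r = \<beta>, \<alpha> + \<beta>, 2\<alpha> + \<beta>, 3\<alpha> + \<beta>, 3\<alpha> + 2\<beta>\<close> and is a central product
  of two quaternion groups.  The element \<open>x\<^sub>\<alpha>(1) x\<^sub>-\<^sub>\<alpha>(1)\<close> of order \<open>3\<close> centralizes one of them
  and extends the other to a copy of \<open>SL\<^sub>2(3)\<close>.  So two noncommuting elements of order \<open>3\<close> in the
  latter commute with two noncommuting elements of order \<open>4\<close> in the former.

  In both cases the elements are words with integer parameters in the root elements, so the
  required relations are identities of integral \<open>14 \<times> 14\<close> matrices, exact ones for odd \<open>q\<close> and
  modulo \<open>2\<close> for even \<open>q\<close>.  They hold over every field of the given characteristic once they are
  verified by evaluation on sparse integer vectors (\<open>odd_words\<close> and \<open>even_words\<close>).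
\<close>

section \<open>Induced octagons in power graphs\<close>

context group
begin

lemma pow_cong_exponent:
  assumes "x \<in> carrier G" "x [^] m = \<one>" "[u = v] (mod m)"
  shows "x [^] u = x [^] (v::nat)"
proof -
  have red: "x [^] w = x [^] (w mod m)" for w :: nat
  proof -
    have "x [^] w = x [^] (m * (w div m) + w mod m)"
      by simp
    also have "\<dots> = (x [^] m) [^] (w div m) \<otimes> x [^] (w mod m)"
      using assms(1) by (simp only: nat_pow_mult [symmetric] nat_pow_pow)
    finally show ?thesis
      using assms(1,2) by simp
  qed
  show ?thesis
    using assms(3) red [of u] red [of v] by (simp add: cong_def)
qed

text \<open>Raising an equation to an exponent that is \<open>1\<close> modulo one of \<open>m, n\<close> and \<open>0\<close> modulo the
  other separates the two factors.\<close>

lemma power_of_coprime_product_iff: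
  assumes carr: "x \<in> carrier G" "s \<in> carrier G" "y \<in> carrier G" "t \<in> carrier G"
    and comm: "x \<otimes> s = s \<otimes> x" "y \<otimes> t = t \<otimes> y"
    and ord: "x [^] (m::nat) = \<one>" "y [^] m = \<one>" "s [^] (n::nat) = \<one>" "t [^] n = \<one>"
    and mn: "coprime m n"
  shows "x \<otimes> s = (y \<otimes> t) [^] (k::nat) \<longleftrightarrow> x = y [^] k \<and> s = t [^] k"
proof
  assume eq: "x \<otimes> s = (y \<otimes> t) [^] k"
  have part: "x [^] u = (y [^] k) [^] u \<and> s [^] v = (t [^] k) [^] v"
    if u: "[u = 1] (mod m)" "[u = 0] (mod n)" and v: "[v = 0] (mod m)" "[v = 1] (mod n)" for u v
  proof -
    have "x [^] w \<otimes> s [^] w = (y [^] k) [^] w \<otimes> (t [^] k) [^] w" for w :: nat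
      using eq carr comm
      by (metis m_closed nat_pow_pow pow_mult_distrib)
    moreover have "s [^] u = \<one>" "x [^] v = \<one>"
      using pow_cong_exponent [OF carr(2) ord(3) u(2)] pow_cong_exponent [OF carr(1) ord(1) v(1)]
      by simp_all
    moreover have "(t [^] k) [^] u = \<one>" "(y [^] k) [^] v = \<one>"
      using pow_cong_exponent [OF carr(4) ord(4) u(2)] pow_cong_exponent [OF carr(3) ord(2) v(1)] carr
      by (simp_all add: nat_pow_pow mult.commute [of k]) (simp_all flip: nat_pow_pow)
    ultimately show ?thesis
      using carr by (metis l_one r_one nat_pow_closed)
  qed
  obtain u where u: "[u = 1] (mod m)" "[u = 0] (mod n)"
    using binary_chinese_remainder_nat [OF mn] by blast
  obtain v where v: "[v = 0] (mod m)" "[v = 1] (mod n)"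
    using binary_chinese_remainder_nat [OF mn] by blast
  have one: "z [^] u = z" if "z \<in> carrier G" "z [^] m = \<one>" for z
    using pow_cong_exponent [OF that u(1)] that by simp
  have one': "z [^] v = z" if "z \<in> carrier G" "z [^] n = \<one>" for z
    using pow_cong_exponent [OF that v(2)] that by simp
  have "(y [^] k) [^] m = \<one>" "(t [^] k) [^] n = \<one>"
    using carr ord by (simp_all add: nat_pow_pow mult.commute [of k]) (simp_all flip: nat_pow_pow)
  then show "x = y [^] k \<and> s = t [^] k"
    using part [OF u v] one one' carr ord by simp
next
  assume "x = y [^] k \<and> s = t [^] k"
  then show "x \<otimes> s = (y \<otimes> t) [^] k"
    using carr comm by (simp add: pow_mult_distrib)
qed

lemma noncommuting_not_power:
  assumes "x \<in> carrier G" "y \<in> carrier G" "x \<otimes> y \<noteq> y \<otimes> x"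
  shows "x \<noteq> y [^] (k::nat)"
proof
  assume x: "x = y [^] k"
  have "y [^] k \<otimes> y = y \<otimes> y [^] k"
    using assms(2) nat_pow_comm [of y k 1] by simp
  with assms(3) x show False by simp
qed

lemma power_graph_edge_iff:
  assumes "x \<in> carrier G" "y \<in> carrier G"
  shows "{x, y} \<in> snd (power_graph G) \<longleftrightarrow> x \<noteq> y \<and>
    ((\<exists>k::nat. k > 0 \<and> x = y [^] k) \<or> (\<exists>k::nat. k > 0 \<and> y = x [^] k))"
proof -
  define adj where "adj a b \<longleftrightarrow> a \<in> carrier G \<and> b \<in> carrier G \<and> a \<noteq> b \<and>
    ((\<exists>k::nat. k > 0 \<and> a = b [^] k) \<or> (\<exists>k::nat. k > 0 \<and> b = a [^] k))" for a b
  have sym: "adj b a" if "adj a b" for a b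
    using that unfolding adj_def by blast
  have "snd (power_graph G) = {{a, b} | a b. adj a b}"
    unfolding power_graph_def adj_def by simp
  then have "{x, y} \<in> snd (power_graph G) \<longleftrightarrow> (\<exists>a b. {x, y} = {a, b} \<and> adj a b)"
    by simp
  also have "\<dots> \<longleftrightarrow> adj x y"
    unfolding doubleton_eq_iff by (blast intro: sym)
  finally show ?thesis
    using assms by (simp add: adj_def)
qed

text \<open>The octagon consists of products \<open>xs\<close> with \<open>x \<in> {1, a, b}\<close> and \<open>s \<in> {1, c, d}\<close>.  On such
  products the relation of being a power is the product of the partial orders on the two factors
  in which \<open>1\<close> is the least element and the other two elements are incomparable.\<close>

theorem power_graph_not_chordal:
  assumes carr: "a \<in> carrier G" "b \<in> carrier G" "c \<in> carrier G" "d \<in> carrier G"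
    and comm: "a \<otimes> c = c \<otimes> a" "a \<otimes> d = d \<otimes> a" "b \<otimes> c = c \<otimes> b" "b \<otimes> d = d \<otimes> b"
    and noncomm: "a \<otimes> b \<noteq> b \<otimes> a" "c \<otimes> d \<noteq> d \<otimes> c"
    and ord: "a [^] (m::nat) = \<one>" "b [^] m = \<one>" "c [^] (n::nat) = \<one>" "d [^] n = \<one>"
    and mn: "coprime m n"
  shows "\<not> chordal (power_graph G)"
proof -
  define A where "A = {\<one>, a, b}"
  define C where "C = {\<one>, c, d}"
  define v where "v p = fst p \<otimes> snd p" for p
  define below where "below p q \<longleftrightarrow> (fst p = \<one> \<or> fst p = fst q) \<and> (snd p = \<one> \<or> snd p = snd q)"
    for p q :: "'a \<times> 'a"
  have A: "x \<in> carrier G \<and> x [^] m = \<one>" if "x \<in> A" for x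
    using that carr ord by (auto simp: A_def)
  have C: "x \<in> carrier G \<and> x [^] n = \<one>" if "x \<in> C" for x
    using that carr ord by (auto simp: C_def)
  have AC: "x \<otimes> s = s \<otimes> x" if "x \<in> A" "s \<in> C" for x s
    using that carr comm by (auto simp: A_def C_def)
  have powA: "x = \<one> \<or> x = y" if "x \<in> A" "y \<in> A" "x = y [^] k" for x y and k :: nat
    using that carr noncommuting_not_power [of a b k] noncommuting_not_power [of b a k] noncomm
    by (auto simp: A_def)
  have powC: "x = \<one> \<or> x = y" if "x \<in> C" "y \<in> C" "x = y [^] k" for x y and k :: nat
    using that carr noncommuting_not_power [of c d k] noncommuting_not_power [of d c k] noncomm
    by (auto simp: C_def)
  have ne: "a \<noteq> \<one>" "b \<noteq> \<one>" "a \<noteq> b" "c \<noteq> \<one>" "d \<noteq> \<one>" "c \<noteq> d"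
    using noncomm carr by auto
  have mn_pos: "m > 0" "n > 0"
    using mn ne ord carr by (auto intro!: Nat.gr0I)
  have power: "v p = v q [^] k \<longleftrightarrow> fst p = fst q [^] k \<and> snd p = snd q [^] k"
    if "p \<in> A \<times> C" "q \<in> A \<times> C" for p q and k :: nat
    using that A C AC unfolding v_def
    by (intro power_of_coprime_product_iff [OF _ _ _ _ _ _ _ _ _ _ mn]) auto
  have inj: "v p = v q \<longleftrightarrow> p = q" if "p \<in> A \<times> C" "q \<in> A \<times> C" for p q
  proof -
    have "v q \<in> carrier G" "fst q \<in> carrier G" "snd q \<in> carrier G"
      using that A C by (auto simp: v_def)
    then show ?thesis
      using power [OF that, of 1] by (simp add: prod_eq_iff)
  qed
  have power_iff: "(\<exists>k::nat. k > 0 \<and> v p = v q [^] k) \<longleftrightarrow> below p q"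
    if pq: "p \<in> A \<times> C" "q \<in> A \<times> C" for p q
  proof
    assume "\<exists>k::nat. k > 0 \<and> v p = v q [^] k"
    then obtain k :: nat where "fst p = fst q [^] k" "snd p = snd q [^] k"
      using power [OF pq] by blast
    then show "below p q"
      using powA [of "fst p" "fst q" k] powC [of "snd p" "snd q" k] pq
      unfolding below_def mem_Times_iff by blast
  next
    assume b: "below p q"
    define i j :: nat where "i = (if fst p = \<one> then 0 else 1)" and "j = (if snd p = \<one> then 0 else 1)"
    obtain k0 where k0: "[k0 = i] (mod m)" "[k0 = j] (mod n)"
      using binary_chinese_remainder_nat [OF mn] by blast
    \<comment> \<open>\<open>k0\<close> may be \<open>0\<close>, but adjacency in a power graph asks for a positive exponent\<close>
    define k where "k = k0 + m * n"
    have k: "[k = i] (mod m)" "[k = j] (mod n)" "k > 0"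
      using k0 mn_pos by (simp_all add: k_def cong_def)
    have "fst p = fst q [^] k"
      using pow_cong_exponent [OF _ _ k(1), of "fst q"] b A pq by (auto simp: below_def i_def)
    moreover have "snd p = snd q [^] k"
      using pow_cong_exponent [OF _ _ k(2), of "snd q"] b C pq by (auto simp: below_def j_def)
    ultimately show "\<exists>k::nat. k > 0 \<and> v p = v q [^] k"
      using power [OF pq, of k] k(3) by blast
  qed
  have edge: "{v p, v q} \<in> snd (power_graph G) \<longleftrightarrow> p \<noteq> q \<and> (below p q \<or> below q p)"
    if pq: "p \<in> A \<times> C" "q \<in> A \<times> C" for p q
  proof -
    have "v p \<in> carrier G" "v q \<in> carrier G"
      using pq A C by (auto simp: v_def)
    then have "{v p, v q} \<in> snd (power_graph G) \<longleftrightarrow> v p \<noteq> v q \<and>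
        ((\<exists>k::nat. k > 0 \<and> v p = v q [^] k) \<or> (\<exists>k::nat. k > 0 \<and> v q = v p [^] k))"
      by (rule power_graph_edge_iff)
    then show ?thesis
      by (simp only: power_iff [OF pq] power_iff [OF pq(2,1)] inj [OF pq])
  qed
  define ps where "ps = [(a, \<one>), (a, c), (\<one>, c), (b, c), (b, \<one>), (b, d), (\<one>, d), (a, d)]"
  have ps: "set ps \<subseteq> A \<times> C"
    by (auto simp: ps_def A_def C_def)
  have len: "length ps = 8"
    by (simp add: ps_def)
  have "induced_cycle (power_graph G) (map v ps)"
    unfolding induced_cycle_def
  proof (intro conjI allI impI)
    show "distinct (map v ps)"
      using ne ps inj by (auto simp: distinct_map inj_on_def ps_def)
    show "set (map v ps) \<subseteq> fst (power_graph G)"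
      using ps A C by (fastforce simp: power_graph_def v_def)
    fix i j
    assume "i < length (map v ps)" "j < length (map v ps)"
    then have ij: "i < 8" "j < 8" by (simp_all add: len)
    have edge_ij: "{map v ps ! i, map v ps ! j} \<in> snd (power_graph G) \<longleftrightarrow>
        ps ! i \<noteq> ps ! j \<and> (below (ps ! i) (ps ! j) \<or> below (ps ! j) (ps ! i))"
    proof -
      have "ps ! i \<in> A \<times> C" "ps ! j \<in> A \<times> C"
        using ps ij len by (metis nth_mem subsetD)+
      then show ?thesis
        using ij by (simp add: edge len)
    qed
    have "i \<in> {0, 1, 2, 3, 4, 5, 6, 7}" "j \<in> {0, 1, 2, 3, 4, 5, 6, 7}"
      using ij by auto
    then show "{map v ps ! i, map v ps ! j} \<in> snd (power_graph G) \<longleftrightarrow>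
        j = Suc i mod length (map v ps) \<or> i = Suc j mod length (map v ps)"
      unfolding edge_ij length_map len
      by (elim insertE emptyE; simp add: ps_def below_def ne ne [symmetric])
  qed (simp add: len)
  then show ?thesis
    unfolding chordal_def using len by (metis length_map numeral_le_iff semiring_norm(68,71) order_refl)
qed

end

section \<open>Evaluating words in the root elements\<close>

text \<open>The parameters are integers so that one word denotes an element over every field.\<close>

definition word_elt :: "(g2_root \<times> int) list \<Rightarrow> 'k::field^g2_basis^g2_basis" where
  "word_elt w = foldr (\<lambda>(r, k). (**) (root_elt r (of_int k))) w (mat 1)"

lemma word_elt_Nil: "word_elt [] = mat 1"
  by (simp add: word_elt_def)

lemma word_elt_Cons: "word_elt ((r, k) # w) = root_elt r (of_int k) ** word_elt w"
  by (simp add: word_elt_def)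

lemma word_elt_append: "word_elt (v @ w) = word_elt v ** word_elt w"
  by (induction v) (auto simp: word_elt_Nil word_elt_Cons matrix_mul_assoc)

text \<open>A word acts on a sparse integer vector letter by letter, with coefficients reduced modulo
  \<open>m\<close> after each letter; \<open>m = 0\<close> means no reduction.  Everything is a recursive function on
  explicit lists: under a binder, symbolic evaluation would start to rewrite before the
  vectors are known.\<close>

fun sp_insert :: "g2_basis \<Rightarrow> int \<Rightarrow> (g2_basis \<times> int) list \<Rightarrow> (g2_basis \<times> int) list" where
  "sp_insert u k [] = [(u, k)]"
| "sp_insert u k ((v, c) # l) = (if u = v then (v, c + k) # l else (v, c) # sp_insert u k l)"

fun sp_collect :: "(g2_basis \<times> int) list \<Rightarrow> (g2_basis \<times> int) list" where
  "sp_collect [] = []"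
| "sp_collect ((u, k) # l) = sp_insert u k (sp_collect l)"

text \<open>Division acts on the entries separately, so it is meaningful only after the entries with the
  same basis vector have been collected.\<close>

fun sp_scale_div :: "int \<Rightarrow> int \<Rightarrow> (g2_basis \<times> int) list \<Rightarrow> (g2_basis \<times> int) list" where
  "sp_scale_div k i [] = []"
| "sp_scale_div k i ((u, c) # l) =
     (if c = 0 then sp_scale_div k i l else (u, k * c div i) # sp_scale_div k i l)"

fun sp_mod :: "int \<Rightarrow> (g2_basis \<times> int) list \<Rightarrow> (g2_basis \<times> int) list" where
  "sp_mod m [] = []"
| "sp_mod m ((u, c) # l) = (if c mod m = 0 then sp_mod m l else (u, c mod m) # sp_mod m l)"

text \<open>The terms of the exponential series: the divided powers are built up one factor
  \<open>k ad e\<^sub>r / i\<close> at a time, which keeps every intermediate vector integral.\<close>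

fun exp_terms :: "g2_root \<Rightarrow> int \<Rightarrow> int list \<Rightarrow> (g2_basis \<times> int) list \<Rightarrow> (g2_basis \<times> int) list" where
  "exp_terms r k [] l = l"
| "exp_terms r k (i # is) l =
     l @ exp_terms r k is (sp_scale_div k i (sp_collect (sp_apply (Evec r) l)))"

fun sp_word :: "int \<Rightarrow> (g2_root \<times> int) list \<Rightarrow> (g2_basis \<times> int) list \<Rightarrow> (g2_basis \<times> int) list" where
  "sp_word m [] l = l"
| "sp_word m ((r, k) # w) l = sp_mod m (sp_collect (exp_terms r k [1, 2, 3] (sp_word m w l)))"

lemma sp_coeff_simps [simp]:
  "sp_coeff [] z = 0"
  "sp_coeff ((u, k) # l) z = (if u = z then k else 0) + sp_coeff l z"
  by (simp_all add: sp_coeff_def)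

lemma sp_coeff_insert: "sp_coeff (sp_insert u k l) z = (if u = z then k else 0) + sp_coeff l z"
  by (induction u k l rule: sp_insert.induct) auto

lemma sp_coeff_collect: "sp_coeff (sp_collect l) z = sp_coeff l z"
  by (induction l rule: sp_collect.induct) (auto simp: sp_coeff_insert)

lemma distinct_sp_collect: "distinct (map fst (sp_collect l))"
proof -
  have keys: "fst ` set (sp_insert u k l) = insert u (fst ` set l)" for u k l
    by (induction u k l rule: sp_insert.induct) auto
  have "distinct (map fst (sp_insert u k l))" if "distinct (map fst l)" for u k l
    using that by (induction u k l rule: sp_insert.induct) (auto simp: keys)
  then show ?thesis
    by (induction l rule: sp_collect.induct) auto
qed

lemma sp_coeff_scale_div:
  "distinct (map fst l) \<Longrightarrow> sp_coeff (sp_scale_div k i l) z = k * sp_coeff l z div i"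
proof (induction k i l rule: sp_scale_div.induct)
  case (2 k i u c l)
  have keys: "fst ` set (sp_scale_div k i l) \<subseteq> fst ` set l"
    by (induction k i l rule: sp_scale_div.induct) auto
  show ?case
  proof (cases "u = z")
    case True
    with 2(3) have "z \<notin> fst ` set l" by auto
    moreover have "z \<notin> fst ` set (sp_scale_div k i l)"
      using \<open>z \<notin> fst ` set l\<close> keys by blast
    ultimately show ?thesis
      using True by (simp add: sp_coeff_eq_0)
  qed (use 2 in auto)
qed simp

text \<open>This is the identity \<open>(ad e\<^sub>r) D\<^sub>i = (i + 1) D\<^bsub>i+1\<^esub>\<close> for the divided powers \<open>D\<^sub>i\<close>; it shows
  that the division by \<open>i + 1\<close> is exact.\<close>

lemma sp_coeff_exp_step:
  assumes l: "\<And>z. sp_coeff l z = k ^ i * (\<Sum>y\<in>UNIV. divided_power r i $ z $ y * c y)"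
  shows "sp_coeff (sp_scale_div k (int (Suc i)) (sp_collect (sp_apply (Evec r) l))) z =
    k ^ Suc i * (\<Sum>y\<in>UNIV. divided_power r (Suc i) $ z $ y * c y)"
proof -
  have D1: "divided_power r 1 $ z $ u = lie_coeff (Evec r) u z" for u
    by (simp add: divided_power_def ad_root_def)
  have "sp_coeff (sp_apply (Evec r) l) z =
      (\<Sum>u\<in>UNIV. \<Sum>y\<in>UNIV. k ^ i * (divided_power r 1 $ z $ u * divided_power r i $ u $ y) * c y)"
    unfolding sp_coeff_apply l D1 by (simp add: sum_distrib_left mult_ac)
  also have "\<dots> = (\<Sum>y\<in>UNIV. \<Sum>u\<in>UNIV. k ^ i * (divided_power r 1 $ z $ u * divided_power r i $ u $ y) * c y)"
    by (rule sum.swap)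
  also have "\<dots> = (\<Sum>y\<in>UNIV. k ^ i * (\<Sum>u\<in>UNIV. divided_power r 1 $ z $ u * divided_power r i $ u $ y) * c y)"
    by (simp only: sum_distrib_left sum_distrib_right)
  also have "\<dots> = int (Suc i) * (k ^ i * (\<Sum>y\<in>UNIV. divided_power r (Suc i) $ z $ y * c y))"
    unfolding divided_power_mult by (simp add: sum_distrib_left mult_ac del: of_nat_Suc)
  finally have "k * sp_coeff (sp_apply (Evec r) l) z =
      int (Suc i) * (k ^ Suc i * (\<Sum>y\<in>UNIV. divided_power r (Suc i) $ z $ y * c y))"
    by (simp add: mult_ac del: of_nat_Suc)
  then show ?thesis
    unfolding sp_coeff_scale_div [OF distinct_sp_collect] sp_coeff_collect
    by (simp only: nonzero_mult_div_cancel_left of_nat_eq_0_iff nat.distinct not_False_eq_True)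
qed

lemma sp_coeff_exp_terms:
  "sp_coeff (exp_terms r k [1, 2, 3] l) z =
     (\<Sum>i\<le>3. k ^ i * (\<Sum>y\<in>UNIV. divided_power r i $ z $ y * sp_coeff l y))"
proof -
  define step where "step i l = sp_scale_div k i (sp_collect (sp_apply (Evec r) l))" for i l
  define c where "c = sp_coeff l"
  have c0: "sp_coeff l z = k ^ 0 * (\<Sum>y\<in>UNIV. divided_power r 0 $ z $ y * c y)" for z
    by (simp add: divided_power_def c_def mat_def if_distrib [of "\<lambda>x. x * _"] cong: if_cong)
  have c1: "sp_coeff (step 1 l) z = k ^ 1 * (\<Sum>y\<in>UNIV. divided_power r 1 $ z $ y * c y)" for z
    using sp_coeff_exp_step [of l k 0 r c z, OF c0] by (simp add: step_def)
  have c2: "sp_coeff (step 2 (step 1 l)) z = k ^ 2 * (\<Sum>y\<in>UNIV. divided_power r 2 $ z $ y * c y)" for z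
    using sp_coeff_exp_step [of _ k 1 r c z, OF c1] by (simp add: step_def numeral_2_eq_2)
  have c3: "sp_coeff (step 3 (step 2 (step 1 l))) z =
      k ^ 3 * (\<Sum>y\<in>UNIV. divided_power r 3 $ z $ y * c y)" for z
    using sp_coeff_exp_step [of _ k 2 r c z, OF c2] by (simp add: step_def numeral_3_eq_3)
  have upto: "{..3::nat} = {0, 1, 2, 3}" by auto
  have "sp_coeff (exp_terms r k [1, 2, 3] l) z = sp_coeff l z + (sp_coeff (step 1 l) z +
      (sp_coeff (step 2 (step 1 l)) z + sp_coeff (step 3 (step 2 (step 1 l))) z))"
    by (simp add: sp_coeff_append step_def)
  then show ?thesis
    unfolding c0 [of z] c1 c2 c3 upto by (simp add: c_def)
qed

lemma of_int_mod_eq: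
  assumes "of_int m = (0 :: 'k::ring_1)"
  shows "of_int (x mod m) = (of_int x :: 'k)"
  by (metis assms add.left_neutral mult_zero_left mult_div_mod_eq of_int_add of_int_mult)

lemma of_int_sp_coeff_mod:
  assumes "of_int m = (0 :: 'k::ring_1)"
  shows "of_int (sp_coeff (sp_mod m l) z) = (of_int (sp_coeff l z) :: 'k)"
proof (induction l)
  case (Cons p l)
  obtain u c where p: "p = (u, c)" by fastforce
  show ?case
  proof (cases "c mod m = 0")
    case True
    then have "of_int c = (0 :: 'k)"
      by (metis of_int_mod_eq [OF assms] of_int_0)
    with True Cons.IH show ?thesis by (simp add: p)
  qed (use Cons.IH in \<open>simp add: p of_int_mod_eq [OF assms]\<close>)
qed simp

text \<open>Reducing modulo a multiple of the characteristic commutes with passing to the field.\<close>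

lemma sp_coeff_word:
  assumes "of_int m = (0 :: 'k::field)"
  shows "of_int (sp_coeff (sp_word m w l) z) =
    (\<Sum>y\<in>UNIV. word_elt w $ z $ y * (of_int (sp_coeff l y) :: 'k))"
proof (induction w arbitrary: z)
  case Nil
  show ?case
    by (simp add: word_elt_Nil mat_def if_distrib [of "\<lambda>x. x * _"] cong: if_cong)
next
  case (Cons p w)
  obtain r k where p: "p = (r, k)" by fastforce
  define x :: "g2_basis \<Rightarrow> 'k" where "x y = of_int (sp_coeff l y)" for y
  have "of_int (sp_coeff (sp_word m (p # w) l) z) =
      (of_int (\<Sum>i\<le>3. k ^ i * (\<Sum>u\<in>UNIV. divided_power r i $ z $ u * sp_coeff (sp_word m w l) u)) :: 'k)"
    by (simp only: p sp_word.simps of_int_sp_coeff_mod [OF assms] sp_coeff_collect sp_coeff_exp_terms)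
  also have "\<dots> = (\<Sum>i\<le>3. \<Sum>u\<in>UNIV. of_int k ^ i * of_int (divided_power r i $ z $ u) *
      (\<Sum>y\<in>UNIV. word_elt w $ u $ y * x y))"
    by (simp add: Cons.IH x_def sum_distrib_left mult.assoc)
  also have "\<dots> = (\<Sum>u\<in>UNIV. root_elt r (of_int k) $ z $ u * (\<Sum>y\<in>UNIV. word_elt w $ u $ y * x y))"
    unfolding root_elt_nth sum_distrib_right by (rule sum.swap)
  also have "\<dots> = (\<Sum>u\<in>UNIV. \<Sum>y\<in>UNIV. root_elt r (of_int k) $ z $ u * word_elt w $ u $ y * x y)"
    by (simp add: sum_distrib_left mult.assoc)
  also have "\<dots> = (\<Sum>y\<in>UNIV. \<Sum>u\<in>UNIV. root_elt r (of_int k) $ z $ u * word_elt w $ u $ y * x y)"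
    by (rule sum.swap)
  also have "\<dots> = (\<Sum>y\<in>UNIV. word_elt (p # w) $ z $ y * x y)"
    by (simp add: p word_elt_Cons matrix_matrix_mult_def sum_distrib_right)
  finally show ?case by (simp add: x_def)
qed

lemma word_elt_nth:
  assumes "of_int m = (0 :: 'k::field)"
  shows "word_elt w $ z $ y = (of_int (sp_coeff (sp_word m w [(y, 1)]) z) :: 'k)"
proof -
  have "sp_coeff [(y, 1)] u = (if u = y then 1 else 0)" for u
    by (simp add: sp_coeff_def)
  then show ?thesis
    by (simp add: sp_coeff_word [OF assms] if_distrib [of of_int] if_distrib [of "(*) _"] cong: if_cong)
qed

text \<open>Sparse vectors list their entries in no canonical order, so two columns are compared
  through their difference.\<close>

fun words_agree_on ::
    "g2_basis list \<Rightarrow> int \<Rightarrow> (g2_root \<times> int) list \<Rightarrow> (g2_root \<times> int) list \<Rightarrow> bool" where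
  "words_agree_on [] m v w = True"
| "words_agree_on (y # ys) m v w =
     (sp_mod m (sp_collect (sp_word m v [(y, 1)] @ sp_scale_div (- 1) 1 (sp_collect (sp_word m w [(y, 1)])))) = []
      \<and> words_agree_on ys m v w)"

abbreviation words_agree :: "int \<Rightarrow> (g2_root \<times> int) list \<Rightarrow> (g2_root \<times> int) list \<Rightarrow> bool" where
  "words_agree \<equiv> words_agree_on g2_basis_list"

definition entry_diff ::
    "int \<Rightarrow> (g2_root \<times> int) list \<Rightarrow> (g2_root \<times> int) list \<Rightarrow> g2_basis \<Rightarrow> g2_basis \<Rightarrow> int" where
  "entry_diff m v w z y = sp_coeff (sp_word m v [(y, 1)]) z - sp_coeff (sp_word m w [(y, 1)]) z"

lemma word_elt_eqI:
  assumes "words_agree m v w" "of_int m = (0 :: 'k::field)"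
  shows "word_elt v = (word_elt w :: 'k^g2_basis^g2_basis)"
proof -
  have "word_elt v $ z $ y = (word_elt w $ z $ y :: 'k)"
    if "words_agree_on ys m v w" "y \<in> set ys" for ys y z
    using that
  proof (induction ys)
    case (Cons x ys)
    show ?case
    proof (cases "y = x")
      case True
      let ?d = "sp_word m v [(y, 1)] @ sp_scale_div (- 1) 1 (sp_collect (sp_word m w [(y, 1)]))"
      have "sp_mod m (sp_collect ?d) = []"
        using Cons.prems True by simp
      then have "of_int (sp_coeff ?d z) = (0 :: 'k)"
        using of_int_sp_coeff_mod [OF assms(2), of "sp_collect ?d" z] by (simp add: sp_coeff_collect)
      then show ?thesis
        by (simp add: word_elt_nth [OF assms(2)] sp_coeff_append sp_coeff_scale_div
            distinct_sp_collect sp_coeff_collect)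
    qed (use Cons in auto)
  qed simp
  with assms(1) show ?thesis
    by (simp add: vec_eq_iff set_g2_basis_list)
qed

lemma word_elt_neqI:
  assumes "of_int (entry_diff m v w z y) \<noteq> (0 :: 'k)" and "of_int m = (0 :: 'k::field)"
  shows "word_elt v \<noteq> (word_elt w :: 'k^g2_basis^g2_basis)"
proof
  assume "word_elt v = (word_elt w :: 'k^g2_basis^g2_basis)"
  then have "of_int (entry_diff m v w z y) = (0 :: 'k)"
    by (simp add: entry_diff_def flip: word_elt_nth [OF assms(2)])
  with assms(1) show False ..
qed

section \<open>Two noncommuting pairs in the Chevalley group\<close>

lemma G2_mult [simp]: "x \<otimes>\<^bsub>G2\<^esub> y = x ** y"
  by (simp add: G2_def subgroup_generated_def GL_def)

lemma G2_one [simp]: "\<one>\<^bsub>G2\<^esub> = mat 1"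
  by (simp add: G2_def subgroup_generated_def GL_def)

lemma word_elt_in_G2: "(word_elt w :: 'k::field^g2_basis^g2_basis) \<in> carrier G2"
proof (induction w)
  case Nil
  show ?case
    using monoid.one_closed [OF group.is_monoid [OF group_G2]] by (simp add: word_elt_Nil)
next
  case (Cons p w)
  obtain r k where p: "p = (r, k)" by fastforce
  show ?case
    using monoid.m_closed [OF group.is_monoid [OF group_G2] root_elt_in_G2 Cons.IH]
    by (simp add: p word_elt_Cons)
qed

lemma word_elt_pow:
  "word_elt w [^]\<^bsub>G2\<^esub> n = (word_elt (concat (replicate n w)) :: 'k::field^g2_basis^g2_basis)"
proof (induction n)
  case 0
  show ?case
    by (simp add: monoid.nat_pow_0 [OF group.is_monoid [OF group_G2]] word_elt_Nil)
next
  case (Suc n)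
  have "concat (replicate (Suc n) w) = concat (replicate n w) @ w"
    by (induction n) auto
  with Suc show ?case
    by (simp add: monoid.nat_pow_Suc [OF group.is_monoid [OF group_G2]] word_elt_append)
qed

lemma root_elt_pow: "root_elt r t [^]\<^bsub>G2\<^esub> n = root_elt r (of_nat n * t)"
proof (induction n)
  case 0
  show ?case
    by (simp add: monoid.nat_pow_0 [OF group.is_monoid [OF group_G2]] root_elt_0)
next
  case (Suc n)
  then show ?case
    by (simp add: monoid.nat_pow_Suc [OF group.is_monoid [OF group_G2]] root_elt_add
        algebra_simps)
qed

text \<open>The orders of \<open>a\<close> and \<open>b\<close> are not checked by evaluation, because in odd characteristic
  they are the unbounded number \<open>p\<close>.\<close>

theorem G2_power_graph_not_chordal_if_words:
  fixes a b c d :: "(g2_root \<times> int) list"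
  defines "X \<equiv> (word_elt :: _ \<Rightarrow> 'k::field^g2_basis^g2_basis)"
  assumes e: "of_int e = (0 :: 'k)"
    and comm: "words_agree e (a @ c) (c @ a)" "words_agree e (a @ d) (d @ a)"
      "words_agree e (b @ c) (c @ b)" "words_agree e (b @ d) (d @ b)"
    and noncomm: "of_int (entry_diff e (a @ b) (b @ a) z y) \<noteq> (0 :: 'k)"
      "of_int (entry_diff e (c @ d) (d @ c) z' y') \<noteq> (0 :: 'k)"
    and ord: "X a [^]\<^bsub>G2\<^esub> (m::nat) = mat 1" "X b [^]\<^bsub>G2\<^esub> m = mat 1"
      "words_agree e (concat (replicate n c)) []" "words_agree e (concat (replicate n d)) []"
    and mn: "coprime m n"
  shows "\<not> chordal (power_graph (G2 :: ('k^g2_basis^g2_basis) monoid))"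
proof (rule group.power_graph_not_chordal [OF group_G2 _ _ _ _ _ _ _ _ _ _ _ _ _ _ mn,
      of "X a" "X b" "X c" "X d"])
  show "X a \<otimes>\<^bsub>G2\<^esub> X c = X c \<otimes>\<^bsub>G2\<^esub> X a" "X a \<otimes>\<^bsub>G2\<^esub> X d = X d \<otimes>\<^bsub>G2\<^esub> X a"
    "X b \<otimes>\<^bsub>G2\<^esub> X c = X c \<otimes>\<^bsub>G2\<^esub> X b" "X b \<otimes>\<^bsub>G2\<^esub> X d = X d \<otimes>\<^bsub>G2\<^esub> X b"
    using comm [THEN word_elt_eqI, OF e] by (simp_all add: X_def flip: word_elt_append)
  show "X a \<otimes>\<^bsub>G2\<^esub> X b \<noteq> X b \<otimes>\<^bsub>G2\<^esub> X a" "X c \<otimes>\<^bsub>G2\<^esub> X d \<noteq> X d \<otimes>\<^bsub>G2\<^esub> X c"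
    using noncomm [THEN word_elt_neqI, OF e] by (simp_all add: X_def flip: word_elt_append)
  show "X c [^]\<^bsub>G2\<^esub> n = \<one>\<^bsub>G2\<^esub>" "X d [^]\<^bsub>G2\<^esub> n = \<one>\<^bsub>G2\<^esub>"
    using ord(3,4) [THEN word_elt_eqI, OF e] by (simp_all add: X_def word_elt_pow word_elt_Nil)
qed (use ord(1,2) in \<open>simp_all add: X_def word_elt_in_G2\<close>)

text \<open>The words \<open>c\<close> and \<open>d\<close> have the form \<open>x\<^sub>r(t) x\<^sub>-\<^sub>r(u)\<close> with \<open>tu = - 2\<close>.  In \<open>SL\<^sub>2\<close> such a product
  has trace \<open>2 + tu = 0\<close>, hence order \<open>4\<close>.  The values \<open>1\<close> and \<open>2\<close> of the entries that witness
  noncommutation are units in odd characteristic.\<close>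

lemma odd_words:
  defines "a \<equiv> [(Pos P10, 1)]" and "b \<equiv> [(Neg P10, 1)]"
    and "c \<equiv> [(Pos P32, 2), (Neg P32, - 1)]" and "d \<equiv> [(Pos P32, 1), (Neg P32, - 2)]"
  shows "words_agree 0 (a @ c) (c @ a)" "words_agree 0 (a @ d) (d @ a)"
    "words_agree 0 (b @ c) (c @ b)" "words_agree 0 (b @ d) (d @ b)"
    "entry_diff 0 (a @ b) (b @ a) (Evec (Pos P11)) (Evec (Pos P31)) = 1"
    "entry_diff 0 (c @ d) (d @ c) (Evec (Pos P01)) (Evec (Neg P31)) = 2"
    "words_agree 0 (concat (replicate 4 c)) []" "words_agree 0 (concat (replicate 4 d)) []"
  unfolding a_def b_def c_def d_def by code_simp+

text \<open>Here \<open>c\<close> and \<open>d\<close> are elements of order \<open>4\<close> of the quaternion group centralized by \<open>a\<close>, and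
  \<open>b\<close> is the product of \<open>a\<close> with an element of order \<open>4\<close> of the other one.  The order of the last
  two letters of \<open>b\<close> matters: exchanging them multiplies \<open>b\<close> by the central involution
  \<open>x\<^bsub>3\<alpha>+2\<beta>\<^esub>(1)\<close> and yields an element of order \<open>6\<close>.\<close>

lemma even_words:
  defines "a \<equiv> [(Pos P10, 1), (Neg P10, 1)]"
    and "b \<equiv> [(Pos P10, 1), (Neg P10, 1), (Pos P31, 1), (Pos P01, 1)]"
    and "c \<equiv> [(Pos P11, 1), (Pos P21, 1)]"
    and "d \<equiv> [(Pos P01, 1), (Pos P21, 1), (Pos P31, 1)]"
  shows "words_agree 2 (a @ c) (c @ a)" "words_agree 2 (a @ d) (d @ a)"
    "words_agree 2 (b @ c) (c @ b)" "words_agree 2 (b @ d) (d @ b)"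
    "\<bar>entry_diff 2 (a @ b) (b @ a) Ha (Evec (Neg P01))\<bar> = 1"
    "\<bar>entry_diff 2 (c @ d) (d @ c) (Evec (Pos P01)) (Evec (Neg P31))\<bar> = 1"
    "words_agree 2 (concat (replicate 3 a)) []" "words_agree 2 (concat (replicate 3 b)) []"
    "words_agree 2 (concat (replicate 4 c)) []" "words_agree 2 (concat (replicate 4 d)) []"
  unfolding a_def b_def c_def d_def by code_simp+

theorem theorem5p11:
  fixes q :: nat
  assumes "primepow q"
    and "CARD('k::{field,finite}) = q"
  shows "\<not> chordal (power_graph (G2 :: ('k^g2_basis^g2_basis) monoid))"
proof -
  have prime: "prime CHAR('k)"
    by (simp add: prime_CHAR_semidom finite_imp_CHAR_pos)
  show ?thesis
  proof (cases "CHAR('k) = 2")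
    case True
    then have e: "of_int 2 = (0 :: 'k)"
      by (metis of_int_numeral of_nat_CHAR of_nat_numeral)
    have unit: "of_int u \<noteq> (0 :: 'k)" if "\<bar>u\<bar> = 1" for u
      using that by (auto simp: abs_if split: if_splits)
    show ?thesis
    proof (rule G2_power_graph_not_chordal_if_words
        [OF e even_words(1-4) unit [OF even_words(5)] unit [OF even_words(6)] _ _
          even_words(9,10), where m = 3])
      show "coprime 3 (4::nat)"
        using coprime_Suc_right_nat [of 3] by simp
    qed (use even_words(7,8) [THEN word_elt_eqI, OF e] in
        \<open>simp_all only: word_elt_pow word_elt_Nil\<close>)
  next
    case False
    have e: "of_int 0 = (0 :: 'k)"
      by simp
    have one: "of_int u \<noteq> (0 :: 'k)" if "u = 1" for u
      using that by simp
    have "(2 :: 'k) \<noteq> 0"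
      using False prime of_nat_eq_0_iff_char_dvd [where ?'a = 'k and n = 2]
      by (metis of_nat_numeral primes_dvd_imp_eq two_is_prime_nat)
    then have two: "of_int u \<noteq> (0 :: 'k)" if "u = 2" for u
      using that by simp
    have "coprime CHAR('k) 2"
      using False prime primes_coprime two_is_prime_nat by blast
    then have "coprime CHAR('k) (2 ^ 2)"
      by (simp only: coprime_power_right_iff simp_thms)
    then have cop: "coprime CHAR('k) 4"
      by simp
    show ?thesis
      by (rule G2_power_graph_not_chordal_if_words
          [OF e odd_words(1-4) one [OF odd_words(5)] two [OF odd_words(6)] _ _ odd_words(7,8) cop])
        (simp_all add: word_elt_Cons word_elt_Nil root_elt_pow root_elt_0)
  qed
qed

end
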